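(* Let $x_0\in\mathbb{R}$ and let $f:I\to\mathbb{C}$ be a differentiable and integrable function on the interval $I=(x_0,+\infty)$. Let $s\in\mathbb{C}$ with $\operatorname{Re}(s)>0$. Then for every $x\in I$ the integral $$J_{x_0}^s(f)(x)=\frac{1}{\Gamma(s)}\int_{x_0}^x (x-y)^{s-1}f(y)\,dy$$ is absolutely convergent.
   Context: $\Gamma$ is the Euler gamma function, and $t^{s-1}=e^{(s-1)\ln t}$ for $t>0$. "Integrable" means integrable on $(x_0,x)$ for every $x>x_0$. *)

theory Defs
  imports "HOL-Analysis.Analysis"
begin

text \<open>
  The integrand of the Riemann-Liouville integral. For \<open>y < x\<close> the base is a positive real, so that
  \<open>of_real (x - y) powr (s - 1)\<close> is \<open>exp ((s - 1) * of_real (ln (x - y)))\<close>.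
\<close>

definition RL_integrand :: "complex \<Rightarrow> (real \<Rightarrow> complex) \<Rightarrow> real \<Rightarrow> real \<Rightarrow> complex" where
  "RL_integrand s f x y = complex_of_real (x - y) powr (s - 1) * f y"

text \<open>
  The Lebesgue integral is \<open>0\<close> by convention when the integrand is not absolutely integrable, so
  convergence cannot be read off the value of \<open>RL_integral\<close>: it is the assertion that
  \<open>RL_integrand s f x\<close> is absolutely integrable on \<open>{x0<..<x}\<close>.
\<close>

definition RL_integral :: "real \<Rightarrow> complex \<Rightarrow> (real \<Rightarrow> complex) \<Rightarrow> real \<Rightarrow> complex" where
  "RL_integral x0 s f x =
     1 / Gamma s * set_lebesgue_integral lebesgue {x0<..<x} (RL_integrand s f x)"

end

theory Submission
  imports Defs
begin

text \<open>
  The integrand \<open>(x - y)\<^sup>s\<^sup>-\<^sup>1 f(y)\<close> is a product of two functions that are integrable but possibly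
  unbounded, and such a product need not be integrable in general. Here it is, because the two factors
  misbehave at opposite ends of the interval: \<open>f\<close> is controlled only in the mean near \<open>x0\<close>, but
  it is differentiable, hence continuous and bounded, near \<open>x\<close>; the kernel
  \<open>(x - y)\<^sup>s\<^sup>-\<^sup>1\<close> may blow up only at \<open>x\<close>, where it is integrable since \<open>Re s > 0\<close>. Cutting at the midpoint makes each half a product of a
  bounded continuous factor and an absolutely integrable one
  (\<open>absolutely_integrable_continuous_mult\<close>), and the only computation left is the integrability of
  the kernel (\<open>RL_kernel_absolutely_integrable\<close>).
\<close>

text \<open>
  The continuity is asked for on a compact interval around \<open>S\<close>, not just on \<open>S\<close>, because it is
  compactness that makes \<open>g\<close> bounded: on a half-open \<open>S\<close>, a continuous \<open>g\<close> could be as singular at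
  the missing end point as \<open>h\<close>, and the product could fail to be integrable.
\<close>

lemma absolutely_integrable_continuous_mult:
  fixes g h :: "real \<Rightarrow> complex"
  assumes "continuous_on {a..b} g" and "S \<subseteq> {a..b}" and "S \<in> sets lebesgue"
    and "h absolutely_integrable_on S"
  shows "(\<lambda>y. g y * h y) absolutely_integrable_on S"
proof (rule absolutely_integrable_bounded_measurable_product[where h = "(*)"])
  show "bilinear ((*) :: complex \<Rightarrow> complex \<Rightarrow> complex)"
    by (rule bilinear_times)
  show "g \<in> borel_measurable (lebesgue_on S)"
    by (intro continuous_imp_measurable_on_sets_lebesgue continuous_on_subset[OF assms(1,2)] assms(3))
  have "compact (g ` {a..b})"
    using assms(1) compact_Icc by (rule compact_continuous_image)
  then show "bounded (g ` S)"
    using assms(2) by (rule bounded_subset[OF compact_imp_bounded image_mono])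
qed (use assms in auto)

lemma integrable_on_diff_powr:
  fixes c x r :: real
  assumes "r > -1" and "c \<le> x"
  shows "(\<lambda>y. (x - y) powr r) integrable_on {c..x}"
proof -
  have "(\<lambda>t. t powr r) integrable_on cbox 0 (x - c)"
    using has_integral_powr_from_0[of r "x - c"] assms by (auto simp: integrable_on_def)
  from integrable_affinity[OF this, of "-1" x]
  have "(\<lambda>y. (x - y) powr r) integrable_on (\<lambda>t. x - t) ` {0..x - c}"
    by simp
  also have "(\<lambda>t. x - t) ` {0..x - c} = {c..x}"
    using assms(2) by simp
  finally show ?thesis .
qed

lemma continuous_on_RL_kernel:
  fixes x :: real and s :: complex
  shows "continuous_on {..<x} (\<lambda>y. complex_of_real (x - y) powr (s - 1))"
  by (intro continuous_intros) (auto simp: complex_nonpos_Reals_iff)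

text \<open>
  The imaginary part of \<open>s\<close> only rotates the values of the kernel, so its modulus is the real power
  \<open>(x - y) powr (Re s - 1)\<close>, whose exponent exceeds \<open>-1\<close>.
\<close>

lemma RL_kernel_absolutely_integrable:
  fixes c x :: real and s :: complex
  assumes "Re s > 0" and "c \<le> x"
  shows "(\<lambda>y. complex_of_real (x - y) powr (s - 1)) absolutely_integrable_on {c<..<x}"
proof (rule measurable_bounded_by_integrable_imp_absolutely_integrable)
  show "(\<lambda>y. complex_of_real (x - y) powr (s - 1)) \<in> borel_measurable (lebesgue_on {c<..<x})"
    by (intro continuous_imp_measurable_on_sets_lebesgue
        continuous_on_subset[OF continuous_on_RL_kernel]) auto
  have "(\<lambda>y. (x - y) powr (Re s - 1)) integrable_on {c..x}"
    using assms by (intro integrable_on_diff_powr) auto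
  then show "(\<lambda>y. (x - y) powr (Re s - 1)) integrable_on {c<..<x}"
    by (simp add: integrable_on_Icc_iff_Ioo)
  show "norm (complex_of_real (x - y) powr (s - 1)) \<le> (x - y) powr (Re s - 1)"
    if "y \<in> {c<..<x}" for y
    using that norm_powr_real_powr[of "complex_of_real (x - y)" "s - 1"] by simp
qed simp

theorem theorem5:
  fixes x0 :: real and f :: "real \<Rightarrow> complex" and s :: complex
  assumes "f differentiable_on {x0<..}"
    and "\<forall>x>x0. f absolutely_integrable_on {x0<..<x}"
    and "Re s > 0"
  shows "\<forall>x>x0. RL_integrand s f x absolutely_integrable_on {x0<..<x}"
proof (intro allI impI)
  fix x :: real
  assume x: "x > x0"
  define c where "c = (x0 + x) / 2"
  have c: "x0 < c" "c < x"
    using x by (auto simp: c_def)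
  let ?K = "\<lambda>y. complex_of_real (x - y) powr (s - 1)"
  have "(\<lambda>y. ?K y * f y) absolutely_integrable_on {x0<..c}"
  proof (rule absolutely_integrable_continuous_mult)
    show "continuous_on {x0..c} ?K"
      using c by (intro continuous_on_subset[OF continuous_on_RL_kernel]) auto
    show "f absolutely_integrable_on {x0<..c}"
    proof (rule set_integrable_subset)
      show "f absolutely_integrable_on {x0<..<x}"
        using assms(2) x by blast
    qed (use c in auto)
  qed auto
  moreover have "(\<lambda>y. f y * ?K y) absolutely_integrable_on {c<..<x}"
  proof (rule absolutely_integrable_continuous_mult)
    show "continuous_on {c..x} f"
      using c by (intro continuous_on_subset[OF differentiable_imp_continuous_on[OF assms(1)]]) auto
    show "?K absolutely_integrable_on {c<..<x}"
      using assms(3) c by (intro RL_kernel_absolutely_integrable) auto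
  qed auto
  ultimately have "(\<lambda>y. ?K y * f y) absolutely_integrable_on {x0<..c} \<union> {c<..<x}"
    by (intro set_integrable_Un) (auto simp: mult.commute)
  moreover have "{x0<..c} \<union> {c<..<x} = {x0<..<x}"
    using c by auto
  ultimately show "RL_integrand s f x absolutely_integrable_on {x0<..<x}"
    by (simp add: RL_integrand_def[abs_def])
qed

end
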